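(* If a finite graph $G$ (possibly with loops) is an NU graph, then the graph obtained from $G$ by removing all loops is SP-trivial.
   Context: Graphs are undirected, may have loops, and have no multiple edges. A homomorphism is an edge-preserving vertex map. $G^k$ is the $k$-fold categorical product: tuples are adjacent iff they are adjacent in every coordinate. For $k\ge 3$, $G$ is a $k$-NU graph if there is a homomorphism $f:G^k\to G$ such that $f(x_1,\dots,x_k)=x$ whenever at least $k-1$ of the $x_i$ are equal to $x$; $G$ is an NU graph if it is a $k$-NU graph for some $k\ge 3$. For vertices $u,v$ of a graph $G$, the shortest path reconfiguration graph $\mathrm{SP}(G,u,v)$ has as vertices the shortest $uv$-paths in $G$, two being adjacent if they differ in exactly one vertex. $G$ is SP-trivial if for all vertices $u,v$ of $G$ and all shortest $uv$-paths $P,Q$ in $G$, there is a path from $P$ to $Q$ in $\mathrm{SP}(G,u,v)$. *)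

theory Defs
  imports "Graph_Theory.Pair_Digraph" "Graph_Theory.Vertex_Walk"
begin

text \<open>
  An undirected graph without multiple edges, possibly with loops, is a symmetric
  \<open>pair_pre_digraph\<close> (\<open>pair_sym_digraph\<close>); the finite ones are exactly the instances of
  \<open>pair_pseudo_graph\<close>. A loop at \<open>x\<close> is the arc \<open>(x, x)\<close>.
\<close>

definition graph_hom ::
    "('a \<Rightarrow> 'b) \<Rightarrow> 'a pair_pre_digraph \<Rightarrow> 'b pair_pre_digraph \<Rightarrow> bool" where
  "graph_hom f G H \<longleftrightarrow>
     (\<forall>x \<in> pverts G. f x \<in> pverts H) \<and>
     (\<forall>x y. (x, y) \<in> parcs G \<longrightarrow> (f x, f y) \<in> parcs H)"

text \<open>The \<open>k\<close>-tuples of vertices of \<open>G\<close> are the lists of length \<open>k\<close> over \<open>pverts G\<close>.\<close>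

definition power_graph :: "'a pair_pre_digraph \<Rightarrow> nat \<Rightarrow> 'a list pair_pre_digraph" where
  "power_graph G k =
     \<lparr> pverts = {xs. length xs = k \<and> set xs \<subseteq> pverts G},
       parcs = {(xs, ys). length xs = k \<and> set xs \<subseteq> pverts G \<and>
                          length ys = k \<and> set ys \<subseteq> pverts G \<and>
                          (\<forall>i<k. (xs ! i, ys ! i) \<in> parcs G)} \<rparr>"

definition k_NU_graph :: "nat \<Rightarrow> 'a pair_pre_digraph \<Rightarrow> bool" where
  "k_NU_graph k G \<longleftrightarrow>
     (\<exists>f. graph_hom f (power_graph G k) G \<and>
          (\<forall>xs \<in> pverts (power_graph G k). \<forall>x \<in> pverts G.
             card {i. i < k \<and> xs ! i = x} \<ge> k - 1 \<longrightarrow> f xs = x))"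

definition NU_graph :: "'a pair_pre_digraph \<Rightarrow> bool" where
  "NU_graph G \<longleftrightarrow> (\<exists>k\<ge>3. k_NU_graph k G)"

definition remove_loops :: "'a pair_pre_digraph \<Rightarrow> 'a pair_pre_digraph" where
  "remove_loops G = \<lparr> pverts = pverts G, parcs = parcs G - Id \<rparr>"

definition path_between :: "'a pair_pre_digraph \<Rightarrow> 'a \<Rightarrow> 'a \<Rightarrow> 'a vwalk \<Rightarrow> bool" where
  "path_between G u v p \<longleftrightarrow> vpath p (with_proj G) \<and> hd p = u \<and> last p = v"

definition shortest_path :: "'a pair_pre_digraph \<Rightarrow> 'a \<Rightarrow> 'a \<Rightarrow> 'a vwalk \<Rightarrow> bool" where
  "shortest_path G u v p \<longleftrightarrow>
     path_between G u v p \<and>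
     (\<forall>q. path_between G u v q \<longrightarrow> vwalk_length p \<le> vwalk_length q)"

text \<open>
  Two shortest \<open>uv\<close>-paths have the same number of vertices; they differ in exactly one vertex
  iff, as vertex sequences, they differ in exactly one position.
\<close>

definition SP_graph :: "'a pair_pre_digraph \<Rightarrow> 'a \<Rightarrow> 'a \<Rightarrow> 'a vwalk pair_pre_digraph" where
  "SP_graph G u v =
     \<lparr> pverts = {P. shortest_path G u v P},
       parcs = {(P, Q). shortest_path G u v P \<and> shortest_path G u v Q \<and>
                        card {i. i < length P \<and> P ! i \<noteq> Q ! i} = 1} \<rparr>"

definition SP_trivial :: "'a pair_pre_digraph \<Rightarrow> bool" where
  "SP_trivial G \<longleftrightarrow>
     (\<forall>u \<in> pverts G. \<forall>v \<in> pverts G. \<forall>P Q.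
        shortest_path G u v P \<longrightarrow> shortest_path G u v Q \<longrightarrow>
        (\<exists>W. path_between (SP_graph G u v) P Q W))"

lemma pair_pseudo_graph_power_graph:
  assumes "pair_pseudo_graph G"
  shows "pair_pseudo_graph (power_graph G k)"
proof -
  let ?V = "{xs. set xs \<subseteq> pverts G \<and> length xs = k}"
  have finV: "finite (pverts G)" and symG: "sym (parcs G)"
    using assms
    by (simp_all add: pair_pseudo_graph_def pair_fin_digraph_def pair_fin_digraph_axioms_def
        pair_sym_digraph_def pair_sym_digraph_axioms_def symmetric_def)
  have fin: "finite ?V"
    using finite_lists_length_eq[OF finV] .
  have verts: "pverts (power_graph G k) = ?V"
    by (auto simp: power_graph_def)
  have arcs: "parcs (power_graph G k) \<subseteq> ?V \<times> ?V"
    by (auto simp: power_graph_def)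
  show ?thesis
  proof
    show "finite (pverts (power_graph G k))"
      using fin by (simp add: verts)
    show "finite (parcs (power_graph G k))"
      using finite_subset[OF arcs] fin by blast
    have "sym (parcs (power_graph G k))"
      unfolding power_graph_def using symD[OF symG] by (intro symI) simp
    then show "symmetric (with_proj (power_graph G k))"
      by (simp add: symmetric_def)
    show "fst e \<in> pverts (power_graph G k)" "snd e \<in> pverts (power_graph G k)"
      if "e \<in> parcs (power_graph G k)" for e
      using subsetD[OF arcs that] by (auto simp: verts)
  qed
qed

lemma pair_graph_remove_loops:
  assumes "pair_pseudo_graph G"
  shows "pair_graph (remove_loops G)"
proof -
  have wf: "pair_wf_digraph G" and fin: "finite (pverts G)" "finite (parcs G)"
    and symG: "sym (parcs G)"
    using assms
    by (simp_all add: pair_pseudo_graph_def pair_fin_digraph_def pair_fin_digraph_axioms_def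
        pair_sym_digraph_def pair_sym_digraph_axioms_def symmetric_def)
  show ?thesis
  proof
    show "symmetric (with_proj (remove_loops G))"
      using symG by (auto simp: symmetric_def remove_loops_def sym_def)
  qed (use wf fin in \<open>auto simp: remove_loops_def pair_wf_digraph_def\<close>)
qed

lemma pair_sym_digraph_SP_graph: "pair_sym_digraph (SP_graph G u v)"
proof -
  have len: "length P = length Q" if "shortest_path G u v P" "shortest_path G u v Q" for P Q
  proof -
    have "vwalk_length P = vwalk_length Q"
      using that by (meson shortest_path_def antisym)
    moreover have "P \<noteq> []" "Q \<noteq> []"
      using that unfolding shortest_path_def path_between_def vpath_def vwalk_def by blast+
    ultimately show ?thesis
      by (cases P; cases Q) simp_all
  qed
  have sym: "(Q, P) \<in> parcs (SP_graph G u v)" if "(P, Q) \<in> parcs (SP_graph G u v)" for P Q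
  proof -
    have sp: "shortest_path G u v P" "shortest_path G u v Q"
      and "card {i. i < length P \<and> P ! i \<noteq> Q ! i} = 1"
      using that by (simp_all add: SP_graph_def)
    then have "card {i. i < length Q \<and> Q ! i \<noteq> P ! i} = 1"
      using len[OF sp] by (simp add: eq_commute)
    with sp show ?thesis
      by (simp add: SP_graph_def)
  qed
  show ?thesis
  proof
    show "symmetric (with_proj (SP_graph G u v))"
      using sym by (simp add: symmetric_def symI)
  qed (simp_all add: SP_graph_def split_beta)
qed

end

theory Submission
  imports Defs
begin

text \<open>
  Let \<open>f\<close> be a \<open>k\<close>-ary near-unanimity polymorphism and let \<open>P\<close>, \<open>Q\<close> be shortest \<open>uv\<close>-paths.
  Applying \<open>f\<close> vertexwise to \<open>i\<close> copies of \<open>P\<close> followed by \<open>k - i\<close> copies of \<open>Q\<close> yields walks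
  \<open>W\<^sub>i\<close> interpolating between \<open>W\<^sub>0 = Q\<close> and \<open>W\<^sub>k = P\<close>. To link \<open>W\<^sub>i\<close> to \<open>W\<^sub>i\<^sub>+\<^sub>1\<close>, put the
  back-and-forth walk \<open>X = u, p\<^sub>1, u, p\<^sub>1, \<dots>\<close> (where \<open>p\<^sub>1\<close> is the second vertex of \<open>P\<close>) into the
  coordinate where they differ. The resulting walk still ends in \<open>v\<close>, because \<open>f\<close> ignores a single
  deviating coordinate, so it is again a shortest path, and it shares its second vertex with
  \<open>W\<^sub>i\<^sub>+\<^sub>1\<close>. Replacing only the first \<open>p\<^sub>1\<close> in \<open>X\<close> by the second vertex of \<open>Q\<close> changes at most the
  second vertex of this path and makes it share its second vertex with \<open>W\<^sub>i\<close>. Shortest paths with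
  a common second vertex are connected by induction on the length.
\<close>

section \<open>Walks, paths and loops\<close>

lemma vwalk_iff_nth:
  "vwalk p (with_proj G) \<longleftrightarrow>
     p \<noteq> [] \<and> set p \<subseteq> pverts G \<and> (\<forall>i. Suc i < length p \<longrightarrow> (p ! i, p ! Suc i) \<in> parcs G)"
proof -
  have "set (vwalk_arcs p) = {(p ! i, p ! Suc i) |i. Suc i < length p}"
  proof (induct p rule: vwalk_arcs.induct)
    case (3 x y xs)
    show ?case (is "?L = ?R")
    proof -
      have "?R = insert (x, y) {((y # xs) ! i, (y # xs) ! Suc i) |i. Suc i < length (y # xs)}"
        (is "_ = ?S")
      proof (intro set_eqI iffI)
        fix e assume "e \<in> ?R"
        then obtain i where "e = ((x # y # xs) ! i, (x # y # xs) ! Suc i)"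
          and "Suc i < length (x # y # xs)" by auto
        then show "e \<in> ?S" by (cases i) auto
      next
        fix e assume "e \<in> ?S"
        then consider "e = (x, y)"
          | i where "e = ((y # xs) ! i, (y # xs) ! Suc i)" "Suc i < length (y # xs)" by auto
        then show "e \<in> ?R"
        proof cases
          case 1
          then have "e = ((x # y # xs) ! 0, (x # y # xs) ! Suc 0)" by simp
          then show ?thesis by force
        next
          case (2 i)
          then have "e = ((x # y # xs) ! Suc i, (x # y # xs) ! Suc (Suc i))"
            "Suc (Suc i) < length (x # y # xs)" by auto
          then show ?thesis by blast
        qed
      qed
      then show ?thesis using 3 by simp
    qed
  qed auto
  then show ?thesis by (auto simp: vwalk_def)
qed

text \<open>Cutting out the closed part at a repeated vertex strictly shortens the walk, so equal
  lengths certify distinctness. This is how a minimal walk is recognised as a path.\<close>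

lemma vwalk_to_vpath_length:
  "length (vwalk_to_vpath p) \<le> length p"
  "length (vwalk_to_vpath p) = length p \<Longrightarrow> distinct p"
proof (induct p rule: vwalk_to_vpath_induct3)
  case (in_set x xs)
  have "length (dropWhile (\<lambda>y. y \<noteq> x) xs) \<le> length xs"
    by (rule length_dropWhile_le)
  with in_set(1,2) have "length (vwalk_to_vpath (x # xs)) < length (x # xs)" by simp
  then show "length (vwalk_to_vpath (x # xs)) \<le> length (x # xs)"
    and "length (vwalk_to_vpath (x # xs)) = length (x # xs) \<Longrightarrow> distinct (x # xs)"
    by linarith+
qed auto

text \<open>The minimum is taken over all walks of \<open>G\<close>, with loops and repeated
  vertices allowed, because walks produced by \<open>f\<close> are a priori of this kind.\<close>

definition geodesic :: "'a pair_pre_digraph \<Rightarrow> 'a \<Rightarrow> 'a \<Rightarrow> 'a vwalk \<Rightarrow> bool" where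
  "geodesic G u v p \<longleftrightarrow> vwalk p (with_proj G) \<and> hd p = u \<and> last p = v \<and>
     (\<forall>q. vwalk q (with_proj G) \<longrightarrow> hd q = u \<longrightarrow> last q = v \<longrightarrow> length p \<le> length q)"

text \<open>The arc set of the reconfiguration graph of \<open>remove_loops G\<close>, as a
  relation, so that connectedness becomes reflexive transitive closure.\<close>

definition reconf :: "'a pair_pre_digraph \<Rightarrow> 'a \<Rightarrow> 'a \<Rightarrow> 'a vwalk rel" where
  "reconf G u v = {(p, q). geodesic G u v p \<and> geodesic G u v q \<and>
     card {i. i < length p \<and> p ! i \<noteq> q ! i} = 1}"

lemma vpath_remove_loops:
  "vpath p (with_proj (remove_loops G)) \<longleftrightarrow> vpath p (with_proj G)"
proof -
  have "p ! i \<noteq> p ! Suc i" if "distinct p" "Suc i < length p" for i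
    using that by (simp add: nth_eq_iff_index_eq)
  then show ?thesis
    by (auto simp: vpath_def vwalk_iff_nth remove_loops_def)
qed

text \<open>Every walk shortens to a path with the same ends, so a minimum over paths is one over
  walks. Conversely a minimal walk cannot be shortened and is therefore a path, and paths avoid
  loops.\<close>

lemma shortest_path_remove_loops:
  "shortest_path (remove_loops G) u v p \<longleftrightarrow> geodesic G u v p"
proof
  assume sp: "shortest_path (remove_loops G) u v p"
  then have p: "vpath p (with_proj G)" "hd p = u" "last p = v"
    by (auto simp: shortest_path_def path_between_def vpath_remove_loops)
  show "geodesic G u v p"
    unfolding geodesic_def
  proof (intro conjI allI impI)
    fix q assume q: "vwalk q (with_proj G)" "hd q = u" "last q = v"
    have "vpath (vwalk_to_vpath q) (with_proj G)"
      using q by (simp add: vwalk_to_vpath_vpath)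
    then have "vwalk_length p \<le> vwalk_length (vwalk_to_vpath q)"
      using sp q
      by (simp add: shortest_path_def path_between_def vpath_remove_loops
          vwalk_to_vpath_hd vwalk_to_vpath_last)
    moreover have "p \<noteq> []" "vwalk_to_vpath q \<noteq> []"
      using p q by (auto simp: vwalk_to_vpath_nonempty)
    ultimately have "length p \<le> length (vwalk_to_vpath q)"
      by (cases p; cases "vwalk_to_vpath q") simp_all
    then show "length p \<le> length q"
      using vwalk_to_vpath_length(1)[of q] by linarith
  qed (use p in auto)
next
  assume g: "geodesic G u v p"
  then have p: "vwalk p (with_proj G)" "hd p = u" "last p = v"
    by (auto simp: geodesic_def)
  have "length p \<le> length (vwalk_to_vpath p)"
    using g vwalk_to_vpath_vpath[OF p(1)] unfolding geodesic_def
    by (auto simp: vpath_def vwalk_to_vpath_hd vwalk_to_vpath_last)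
  then have "distinct p"
    using vwalk_to_vpath_length[of p] by simp
  then have "path_between (remove_loops G) u v p"
    using p by (auto simp: path_between_def vpath_remove_loops)
  moreover have "vwalk_length p \<le> vwalk_length q" if "path_between (remove_loops G) u v q" for q
  proof -
    have "vwalk q (with_proj G)" "hd q = u" "last q = v"
      using that by (auto simp: path_between_def vpath_remove_loops)
    then show ?thesis
      using g by (simp add: geodesic_def diff_le_mono)
  qed
  ultimately show "shortest_path (remove_loops G) u v p"
    by (simp add: shortest_path_def)
qed

section \<open>Geodesics and their reconfiguration\<close>

lemma geodesicD:
  assumes "geodesic G u v p"
  shows "p \<noteq> []" "p ! 0 = u" "vwalk p (with_proj G)"
  using assms by (auto simp: geodesic_def hd_conv_nth vwalk_def)

lemma geodesic_length_eq:
  assumes "geodesic G u v p" "geodesic G u v q"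
  shows "length p = length q"
  using assms unfolding geodesic_def by (intro le_antisym) blast+

lemma geodesicI_length:
  assumes "geodesic G u v p" "vwalk q (with_proj G)" "hd q = u" "last q = v" "length q = length p"
  shows "geodesic G u v q"
  using assms unfolding geodesic_def by simp

lemma geodesic_ConsD:
  assumes "geodesic G u v (u # a # r)"
  shows "geodesic G a v (a # r)" "u \<in> pverts G" "(u, a) \<in> parcs G"
proof -
  have w: "vwalk (u # a # r) (with_proj G)" and l: "last (a # r) = v"
    and min: "\<And>q. vwalk q (with_proj G) \<Longrightarrow> hd q = u \<Longrightarrow> last q = v
      \<Longrightarrow> length (u # a # r) \<le> length q"
    using assms by (auto simp: geodesic_def)
  then show u: "u \<in> pverts G" and e: "(u, a) \<in> parcs G"
    by (auto simp: vwalk_def)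
  have "length (a # r) \<le> length q" if "vwalk q (with_proj G)" "hd q = a" "last q = v" for q
    using min[of "u # q"] that u e by (auto simp: vwalk_consI vwalk_def)
  moreover have "vwalk (a # r) (with_proj G)"
    using w by (auto simp: vwalk_def)
  ultimately show "geodesic G a v (a # r)"
    using l by (simp add: geodesic_def)
qed

lemma geodesic_Cons:
  assumes "geodesic G u v (u # a # r)" "geodesic G a v p"
  shows "geodesic G u v (u # p)"
proof (rule geodesicI_length[OF assms(1)])
  note D = geodesic_ConsD[OF assms(1)]
  show "vwalk (u # p) (with_proj G)"
    using assms(2) D(2,3) by (auto simp: geodesic_def intro: vwalk_consI)
  show "last (u # p) = v"
    using assms(2) by (auto simp: geodesic_def)
  show "length (u # p) = length (u # a # r)"
    using geodesic_length_eq[OF assms(2) D(1)] by simp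
qed simp

text \<open>Prepending \<open>u\<close> merely shifts the differing position by one, so chains
  between tails lift to chains between full paths.\<close>

lemma reconf_rtrancl_Cons:
  assumes "geodesic G u v (u # a # r)" "(p, q) \<in> (reconf G a v)\<^sup>*"
  shows "(u # p, u # q) \<in> (reconf G u v)\<^sup>*"
  using assms(2)
proof induct
  case (step p' q')
  have "{i. i < length (u # p') \<and> (u # p') ! i \<noteq> (u # q') ! i}
      = Suc ` {i. i < length p' \<and> p' ! i \<noteq> q' ! i}" (is "?L = ?R")
  proof (intro set_eqI)
    fix i show "i \<in> ?L \<longleftrightarrow> i \<in> ?R"
      by (cases i) auto
  qed
  then have "(u # p', u # q') \<in> reconf G u v"
    using step(2) geodesic_Cons[OF assms(1)] by (simp add: reconf_def card_image)
  with step(3) show ?case by simp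
qed simp

text \<open>The closure absorbs the case \<open>p = q\<close>, which can arise because changing one
  input of \<open>f\<close> may leave its value unchanged.\<close>

lemma reconf_rtrancl_one_vertex:
  assumes "geodesic G u v p" "geodesic G u v q"
    and "\<And>i. i < length p \<Longrightarrow> i \<noteq> m \<Longrightarrow> p ! i = q ! i"
  shows "(p, q) \<in> (reconf G u v)\<^sup>*"
proof (cases "p = q")
  case False
  then have "\<exists>i < length p. p ! i \<noteq> q ! i"
    using geodesic_length_eq[OF assms(1,2)] by (auto simp: list_eq_iff_nth_eq)
  then have "{i. i < length p \<and> p ! i \<noteq> q ! i} = {m}"
    using assms(3) by auto
  then have "(p, q) \<in> reconf G u v"
    using assms by (simp add: reconf_def)
  then show ?thesis by blast
qed simp

section \<open>Applying a polymorphism to walks position by position\<close>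

definition comb :: "('a list \<Rightarrow> 'a) \<Rightarrow> nat \<Rightarrow> nat \<Rightarrow> (nat \<Rightarrow> 'a vwalk) \<Rightarrow> 'a vwalk" where
  "comb f k n W = map (\<lambda>i. f (map (\<lambda>j. W j ! i) [0..<k])) [0..<n]"

lemma length_comb [simp]: "length (comb f k n W) = n"
  by (simp add: comb_def)

lemma nth_comb: "i < n \<Longrightarrow> comb f k n W ! i = f (map (\<lambda>j. W j ! i) [0..<k])"
  by (simp add: comb_def)

lemma nth_comb_cong:
  assumes "i < n" "\<And>j. j < k \<Longrightarrow> W j ! i = W' j ! i"
  shows "comb f k n W ! i = comb f k n W' ! i"
proof -
  have "map (\<lambda>j. W j ! i) [0..<k] = map (\<lambda>j. W' j ! i) [0..<k]"
    using assms(2) by simp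
  then show ?thesis using assms(1) by (simp only: nth_comb)
qed

text \<open>Walks of a common length, read in parallel, form a walk in the power graph, which
  \<open>f\<close> maps to a walk in \<open>G\<close>.\<close>

lemma vwalk_comb:
  assumes hom: "graph_hom f (power_graph G k) G" and "n > 0"
    and W: "\<And>j. j < k \<Longrightarrow> vwalk (W j) (with_proj G)" "\<And>j. j < k \<Longrightarrow> length (W j) = n"
  shows "vwalk (comb f k n W) (with_proj G)"
proof -
  have V: "W j ! i \<in> pverts G" if "j < k" "i < n" for i j
    using W[OF that(1)] that(2) by (auto simp: vwalk_def)
  have E: "(W j ! i, W j ! Suc i) \<in> parcs G" if "j < k" "Suc i < n" for i j
    using W[OF that(1)] that(2) by (auto simp: vwalk_iff_nth)
  have "f (map (\<lambda>j. W j ! i) [0..<k]) \<in> pverts G" if "i < n" for i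
  proof -
    have "map (\<lambda>j. W j ! i) [0..<k] \<in> pverts (power_graph G k)"
      using V that by (auto simp: power_graph_def)
    then show ?thesis using hom by (auto simp: graph_hom_def)
  qed
  moreover have "(f (map (\<lambda>j. W j ! i) [0..<k]), f (map (\<lambda>j. W j ! Suc i) [0..<k])) \<in> parcs G"
    if "Suc i < n" for i
  proof -
    have "(map (\<lambda>j. W j ! i) [0..<k], map (\<lambda>j. W j ! Suc i) [0..<k]) \<in> parcs (power_graph G k)"
      using V E that by (auto simp: power_graph_def)
    then show ?thesis using hom by (auto simp: graph_hom_def)
  qed
  moreover have "comb f k n W \<noteq> []"
    using \<open>n > 0\<close> by (simp add: comb_def)
  ultimately show ?thesis
    by (auto simp: vwalk_iff_nth nth_comb in_set_conv_nth)
qed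

definition near_unanimous :: "'a pair_pre_digraph \<Rightarrow> nat \<Rightarrow> ('a list \<Rightarrow> 'a) \<Rightarrow> bool" where
  "near_unanimous G k f \<longleftrightarrow>
     (\<forall>xs \<in> pverts (power_graph G k). \<forall>x \<in> pverts G.
        card {i. i < k \<and> xs ! i = x} \<ge> k - 1 \<longrightarrow> f xs = x)"

text \<open>Here \<open>m\<close> is the coordinate allowed to deviate; if it is not below
  \<open>k\<close>, all coordinates agree.\<close>

lemma near_unanimousD:
  assumes "near_unanimous G k f" "x \<in> pverts G"
    and "\<And>j. j < k \<Longrightarrow> g j \<in> pverts G" "\<And>j. j < k \<Longrightarrow> j \<noteq> m \<Longrightarrow> g j = x"
  shows "f (map g [0..<k]) = x"
proof -
  have "k - 1 \<le> card ({..<k} - {m})"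
    by (simp add: card_Diff_singleton_if)
  also have "\<dots> \<le> card {i. i < k \<and> map g [0..<k] ! i = x}"
    using assms(4) by (intro card_mono) auto
  finally have "k - 1 \<le> card {i. i < k \<and> map g [0..<k] ! i = x}" .
  moreover have "map g [0..<k] \<in> pverts (power_graph G k)"
    using assms(3) by (auto simp: power_graph_def)
  ultimately show ?thesis
    using assms(1,2) unfolding near_unanimous_def by blast
qed

text \<open>The walk \<open>W m\<close> may end anywhere: at the last position only coordinate
  \<open>m\<close> can deviate from \<open>v\<close>, and \<open>f\<close> ignores it. A walk with
  the right ends and the right length is a geodesic.\<close>

lemma geodesic_comb:
  assumes hom: "graph_hom f (power_graph G k) G" and nu: "near_unanimous G k f"
    and P: "geodesic G u v P"
    and W: "\<And>j. j < k \<Longrightarrow> vwalk (W j) (with_proj G)" "\<And>j. j < k \<Longrightarrow> length (W j) = length P"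
      "\<And>j. j < k \<Longrightarrow> hd (W j) = u" "\<And>j. j < k \<Longrightarrow> j \<noteq> m \<Longrightarrow> last (W j) = v"
  shows "geodesic G u v (comb f k (length P) W)" (is "geodesic G u v ?C")
proof (rule geodesicI_length[OF P])
  have ne: "P \<noteq> []" and Pw: "vwalk P (with_proj G)" and hP: "hd P = u" "last P = v"
    using P by (auto simp: geodesic_def)
  then have uv: "u \<in> pverts G" "v \<in> pverts G"
    by (auto simp: vwalk_def)
  have neW: "W j \<noteq> []" if "j < k" for j
    using W(2)[OF that] ne by auto
  have V: "W j ! i \<in> pverts G" if "j < k" "i < length P" for i j
    using W(1,2)[OF that(1)] that(2) by (auto simp: vwalk_def)
  have neC: "?C \<noteq> []"
    using ne by (simp add: comb_def)
  show "vwalk ?C (with_proj G)"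
    using vwalk_comb[OF hom] W ne by simp
  have "?C ! 0 = u"
    using ne V W(3) neW near_unanimousD[OF nu uv(1), of "\<lambda>j. W j ! 0"] uv
    by (simp add: nth_comb hd_conv_nth)
  then show "hd ?C = u"
    using neC by (simp add: hd_conv_nth)
  have "?C ! (length P - 1) = v"
    using ne V W(2,4) neW near_unanimousD[OF nu uv(2), of "\<lambda>j. W j ! (length P - 1)" m]
    by (simp add: nth_comb last_conv_nth)
  then show "last ?C = v"
    using neC by (simp add: last_conv_nth)
qed simp

lemma comb_const:
  assumes "near_unanimous G k f" "vwalk P (with_proj G)" "\<And>j. j < k \<Longrightarrow> W j = P"
  shows "comb f k (length P) W = P"
proof (rule nth_equalityI)
  fix i assume i: "i < length (comb f k (length P) W)"
  then have "P ! i \<in> pverts G"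
    using assms(2) by (auto simp: vwalk_def)
  then show "comb f k (length P) W ! i = P ! i"
    using near_unanimousD[OF assms(1), of "P ! i" "\<lambda>j. W j ! i"] i assms(3)
    by (simp add: nth_comb)
qed simp

section \<open>Connecting two geodesics\<close>

lemma reconf_connected:
  assumes wf: "pair_sym_digraph G"
    and hom: "graph_hom f (power_graph G k) G" and nu: "near_unanimous G k f"
    and "geodesic G u v P" "geodesic G u v Q"
  shows "(P, Q) \<in> (reconf G u v)\<^sup>*"
  using assms(4,5)
\<comment> \<open>The start \<open>u\<close> varies because the induction hypothesis is used for
  tails starting at the second vertex.\<close>
proof (induct "length P" arbitrary: u P Q)
  case 0
  then show ?case using geodesicD(1) by force
next
  case (Suc n)
  note P = \<open>geodesic G u v P\<close> and Q = \<open>geodesic G u v Q\<close>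
  have len: "length Q = length P"
    using geodesic_length_eq[OF Q P] .
  show ?case
  \<comment> \<open>One-vertex paths are split off since the main argument inspects position
    1.\<close>
  proof (cases "n = 0")
    case True
    then have "length P = 1" using Suc(2) by simp
    then have "P = Q"
      using len geodesicD(2)[OF P] geodesicD(2)[OF Q] by (intro nth_equalityI) auto
    then show ?thesis by simp
  next
    case False
    define N where "N = length P"
    have N: "2 \<le> N" "length P = N" "length Q = N"
      using False Suc(2) len by (auto simp: N_def)
    have common: "(R, S) \<in> (reconf G u v)\<^sup>*"
      if R: "geodesic G u v R" and S: "geodesic G u v S" and RS: "R ! 1 = S ! 1" for R S
    proof -
      have l: "length R = Suc n" "length S = Suc n"
        using geodesic_length_eq[OF R P] geodesic_length_eq[OF S P] Suc(2) by auto
      have form: "\<exists>r. T = u # T ! 1 # r" if "geodesic G u v T" "length T = Suc n" for T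
        using geodesicD(2)[OF that(1)] that(2) False by (auto simp: length_Suc_conv neq0_conv gr0_conv_Suc)
      obtain a r s where RS: "R = u # a # r" "S = u # a # s"
        using form[OF R l(1)] form[OF S l(2)] RS by metis
      have "(a # r, a # s) \<in> (reconf G a v)\<^sup>*"
        using Suc(1)[of "a # r" a "a # s"] geodesic_ConsD(1)[OF R[unfolded RS]]
          geodesic_ConsD(1)[OF S[unfolded RS]] l unfolding RS by simp
      then show ?thesis
        using reconf_rtrancl_Cons R unfolding RS by metis
    qed
    \<comment> \<open>\<open>X\<close> has the required length and start but need not reach
      \<open>v\<close>. Changing position 1 to give \<open>X'\<close> keeps it a walk, because every
      neighbouring position holds \<open>u\<close>.\<close>
    define X where "X = map (\<lambda>i. if even i then u else P ! 1) [0..<N]"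
    define X' where "X' = X[1 := Q ! 1]"
    have first_arc: "(u, R ! 1) \<in> parcs G" if "geodesic G u v R" "length R = N" for R
    proof -
      have "(R ! 0, R ! Suc 0) \<in> parcs G"
        using geodesicD(3)[OF that(1)] that(2) N(1) unfolding vwalk_iff_nth by simp
      then show ?thesis using geodesicD(2)[OF that(1)] by simp
    qed
    note edges = first_arc[OF P N(2)] first_arc[OF Q N(3)]
    have "sym (parcs G)"
      using wf by (simp add: pair_sym_digraph_def pair_sym_digraph_axioms_def symmetric_def)
    then have rev_edges: "(P ! 1, u) \<in> parcs G" "(Q ! 1, u) \<in> parcs G"
      using edges by (blast dest: symD)+
    have verts: "u \<in> pverts G" "P ! 1 \<in> pverts G" "Q ! 1 \<in> pverts G"
      using edges wf unfolding pair_sym_digraph_def pair_wf_digraph_def by force+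
    have X: "length X = N" "vwalk X (with_proj G)" "hd X = u" "X ! 1 = P ! 1" "X ! 0 = u"
      using N edges rev_edges verts by (auto simp: X_def vwalk_iff_nth hd_conv_nth)
    have X': "length X' = N" "vwalk X' (with_proj G)" "hd X' = u" "X' ! 1 = Q ! 1"
      using N edges rev_edges verts
      by (auto simp: X'_def X_def vwalk_iff_nth hd_conv_nth nth_list_update in_set_conv_nth)
    define W where "W i = comb f k N (\<lambda>j. if j < i then P else Q)" for i
    \<comment> \<open>\<open>Y\<close> sits in the only coordinate where the inputs of
      \<open>W i\<close> and \<open>W (Suc i)\<close> can differ.\<close>
    define T where "T Y i = comb f k N (\<lambda>j. if j < i then P else if j = i then Y else Q)" for Y i
    have PQ: "vwalk P (with_proj G)" "hd P = u" "last P = v"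
      "vwalk Q (with_proj G)" "hd Q = u" "last Q = v"
      using P Q by (auto simp: geodesic_def)
    have gW: "geodesic G u v (W i)" for i
      unfolding W_def N(2)[symmetric] by (rule geodesic_comb[OF hom nu P]) (use PQ N in auto)
    have gT: "geodesic G u v (T Y i)"
      if "vwalk Y (with_proj G)" "hd Y = u" "length Y = N" for Y i
      unfolding T_def N(2)[symmetric]
      by (rule geodesic_comb[OF hom nu P, where m = i]) (use PQ N that in auto)
    have step: "(W (Suc i), W i) \<in> (reconf G u v)\<^sup>*" for i
    proof -
      \<comment> \<open>At position 1, \<open>X\<close> cannot be told from \<open>P\<close>, nor
        \<open>X'\<close> from \<open>Q\<close>.\<close>
      have "(W (Suc i), T X i) \<in> (reconf G u v)\<^sup>*"
        by (rule common[OF gW gT[OF X(2,3,1)]])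
          (use N X(4) in \<open>auto simp: W_def T_def less_Suc_eq intro!: nth_comb_cong\<close>)
      moreover have "(T X i, T X' i) \<in> (reconf G u v)\<^sup>*"
        by (rule reconf_rtrancl_one_vertex[OF gT[OF X(2,3,1)] gT[OF X'(2,3,1)], where m = 1])
          (auto simp: T_def X'_def intro!: nth_comb_cong)
      moreover have "(T X' i, W i) \<in> (reconf G u v)\<^sup>*"
        by (rule common[OF gT[OF X'(2,3,1)] gW])
          (use N X'(4) in \<open>auto simp: W_def T_def intro!: nth_comb_cong\<close>)
      ultimately show ?thesis by (meson rtrancl_trans)
    qed
    have "(W i, W 0) \<in> (reconf G u v)\<^sup>*" for i
      by (induct i) (auto intro: rtrancl_trans[OF step])
    \<comment> \<open>Only coordinates below \<open>k\<close> are read, so all inputs of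
      \<open>W k\<close> are \<open>P\<close>.\<close>
    moreover have "W k = P" "W 0 = Q"
      using comb_const[OF nu PQ(1)] comb_const[OF nu PQ(4)] N by (simp_all add: W_def)
    ultimately show ?thesis by metis
  qed
qed

theorem corollary1p7:
  fixes G :: "'a pair_pre_digraph"
  assumes "pair_pseudo_graph G"
    and "NU_graph G"
  shows "SP_trivial (remove_loops G)"
  unfolding SP_trivial_def
proof (intro ballI allI impI)
  fix u v P Q
  let ?S = "SP_graph (remove_loops G) u v"
  assume PQ: "shortest_path (remove_loops G) u v P" "shortest_path (remove_loops G) u v Q"
  obtain k f where "graph_hom f (power_graph G k) G" "near_unanimous G k f"
    using assms(2) by (auto simp: NU_graph_def k_NU_graph_def near_unanimous_def)
  moreover have "pair_sym_digraph G"
    using assms(1) by (simp add: pair_pseudo_graph_def)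
  ultimately have "(P, Q) \<in> (reconf G u v)\<^sup>*"
    using PQ by (auto simp: shortest_path_remove_loops intro: reconf_connected)
  moreover have "reconf G u v = parcs ?S"
    by (simp add: reconf_def SP_graph_def shortest_path_remove_loops)
  ultimately have "(P, Q) \<in> (parcs ?S)\<^sup>*" by simp
  then have "\<exists>W. vwalk W (with_proj ?S) \<and> hd W = P \<and> last W = Q"
  proof (induct rule: converse_rtrancl_induct)
    case base
    have "vwalk [Q] (with_proj ?S)"
      using PQ by (simp add: vwalk_def SP_graph_def)
    then show ?case by force
  next
    case (step R S)
    then obtain W where W: "vwalk W (with_proj ?S)" "hd W = S" "last W = Q" by blast
    have "vwalk (R # W) (with_proj ?S)"
      using W step(1) by (intro vwalk_consI) (auto simp: SP_graph_def)
    moreover have "last (R # W) = Q"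
      using W by auto
    ultimately show ?case by force
  qed
  then show "\<exists>W. path_between ?S P Q W"
    unfolding path_between_def by (blast dest: vwalk_imp_ex_vpath)
qed

end
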